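(* Let $(\mathcal{X},d)$ be a finite metric space, $p\ge 1$, $C>0$, and let $\mu,\nu$ be non-negative measures on $\mathcal{X}$. Let $\pi_C$ be an optimal solution of the unbalanced optimal transport problem $\mathrm{UOT}_{p,C}(\mu,\nu)$. Then the length of any directed path $P$ in the transport graph $G(\pi_C)$ satisfies $$\mathcal{L}(P)\le C^p.$$ In particular, if $d(x,x')>C$, then $\pi_C(x,x')=0$ for any optimal solution $\pi_C$ of $\mathrm{UOT}_{p,C}(\mu,\nu)$.
   Context: A non-negative measure on the finite set $\mathcal{X}$ is a function $\mu:\mathcal{X}\to[0,\infty)$, with total mass $\mathbb{M}(\mu)=\sum_{x\in\mathcal{X}}\mu(x)$; $\mathcal{M}_+(\mathcal{X})$ is the set of these. For $\pi\in\mathcal{M}_+(\mathcal{X}\times\mathcal{X})$ put $\pi(x,\mathcal{X})=\sum_{x'}\pi(x,x')$ and $\pi(\mathcal{X},x')=\sum_{x}\pi(x,x')$. The set of sub-couplings is $$\Pi_{\le}(\mu,\nu)=\{\pi\in\mathcal{M}_+(\mathcal{X}\times\mathcal{X}) : \pi(x,\mathcal{X})\le\mu(x),\ \pi(\mathcal{X},x')\le\nu(x')\ \ \forall x,x'\in\mathcal{X}\},$$ and $$\mathrm{UOT}_{p,C}(\mu,\nu)=\min_{\pi\in\Pi_{\le}(\mu,\nu)}\ \sum_{x,x'\in\mathcal{X}}d^p(x,x')\pi(x,x')+C^p\left(\frac{\mathbb{M}(\mu)+\mathbb{M}(\nu)}{2}-\mathbb{M}(\pi)\right).$$ For an optimal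 solution $\pi_C$, the directed transport graph $G(\pi_C)$ between the support points of $\mu$ (sources) and the support points of $\nu$ (sinks) contains the directed edge $(x,x')$ if and only if $\pi_C(x,x')>0$. The length of a directed path $P=(x_{i_1},\dots,x_{i_k})$ in $G(\pi_C)$ is $\mathcal{L}(P)=\sum_{j=1}^{k-1}d^p(x_{i_j},x_{i_{j+1}})$. *)

theory Defs
  imports
    "HOL-Analysis.Abstract_Metric_Spaces"
    "Graph_Theory.Digraph"
    "Graph_Theory.Vertex_Walk"
begin

text \<open>
  Measures on a finite carrier \<open>X\<close> are functions on the ambient type whose values outside \<open>X\<close> are
  irrelevant: every notion below inspects them on \<open>X\<close> (respectively \<open>X \<times> X\<close>) only.
\<close>

definition nonneg_measures :: "'a set \<Rightarrow> ('a \<Rightarrow> real) set" where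
  "nonneg_measures X = X \<rightarrow> {0..}"

definition total_mass :: "'a set \<Rightarrow> ('a \<Rightarrow> real) \<Rightarrow> real" where
  "total_mass X \<mu> = (\<Sum>x\<in>X. \<mu> x)"

definition subcouplings :: "'a set \<Rightarrow> ('a \<Rightarrow> real) \<Rightarrow> ('a \<Rightarrow> real) \<Rightarrow> ('a \<times> 'a \<Rightarrow> real) set" where
  "subcouplings X \<mu> \<nu> =
     {\<pi> \<in> nonneg_measures (X \<times> X).
        (\<forall>x\<in>X. (\<Sum>x'\<in>X. \<pi> (x, x')) \<le> \<mu> x) \<and> (\<forall>x'\<in>X. (\<Sum>x\<in>X. \<pi> (x, x')) \<le> \<nu> x')}"

definition uot_cost ::
  "'a set \<Rightarrow> ('a \<Rightarrow> 'a \<Rightarrow> real) \<Rightarrow> real \<Rightarrow> real \<Rightarrow> ('a \<Rightarrow> real) \<Rightarrow> ('a \<Rightarrow> real) \<Rightarrow> ('a \<times> 'a \<Rightarrow> real) \<Rightarrow> real"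
where
  "uot_cost X d p C \<mu> \<nu> \<pi> =
     (\<Sum>x\<in>X. \<Sum>x'\<in>X. d x x' powr p * \<pi> (x, x'))
     + C powr p * ((total_mass X \<mu> + total_mass X \<nu>) / 2 - total_mass (X \<times> X) \<pi>)"

definition uot_optimal ::
  "'a set \<Rightarrow> ('a \<Rightarrow> 'a \<Rightarrow> real) \<Rightarrow> real \<Rightarrow> real \<Rightarrow> ('a \<Rightarrow> real) \<Rightarrow> ('a \<Rightarrow> real) \<Rightarrow> ('a \<times> 'a \<Rightarrow> real) \<Rightarrow> bool"
where
  "uot_optimal X d p C \<mu> \<nu> \<pi> \<longleftrightarrow>
     is_arg_min (uot_cost X d p C \<mu> \<nu>) (\<lambda>\<pi>'. \<pi>' \<in> subcouplings X \<mu> \<nu>) \<pi>"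

text \<open>
  A point lying in the support of both measures is a single vertex, which is both a source and a
  sink; this is what makes paths with more than one arc possible.
\<close>

definition transport_graph ::
  "'a set \<Rightarrow> ('a \<Rightarrow> real) \<Rightarrow> ('a \<Rightarrow> real) \<Rightarrow> ('a \<times> 'a \<Rightarrow> real) \<Rightarrow> ('a, 'a \<times> 'a) pre_digraph"
where
  "transport_graph X \<mu> \<nu> \<pi> =
     \<lparr>verts = {x \<in> X. \<mu> x > 0} \<union> {x \<in> X. \<nu> x > 0},
      arcs = {(x, x') \<in> X \<times> X. \<pi> (x, x') > 0},
      tail = fst, head = snd\<rparr>"

definition path_length :: "('a \<Rightarrow> 'a \<Rightarrow> real) \<Rightarrow> real \<Rightarrow> 'a list \<Rightarrow> real" where
  "path_length d p P = (\<Sum>j<length P - 1. d (P ! j) (P ! Suc j) powr p)"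

text \<open>For sub-couplings every arc runs from a source to a sink.\<close>

lemma subcoupling_arc:
  assumes "finite X" "\<pi> \<in> subcouplings X \<mu> \<nu>" "x \<in> X" "x' \<in> X" "\<pi> (x, x') > 0"
  shows "\<mu> x > 0" "\<nu> x' > 0"
proof -
  have nn: "\<pi> (y, y') \<ge> 0" if "y \<in> X" "y' \<in> X" for y y'
    using assms(2) that by (auto simp: subcouplings_def nonneg_measures_def Pi_iff)
  have "\<pi> (x, x') \<le> (\<Sum>y'\<in>X. \<pi> (x, y'))"
    using assms nn by (intro member_le_sum[where f = "\<lambda>y'. \<pi> (x, y')"]) auto
  also have "\<dots> \<le> \<mu> x"
    using assms by (auto simp: subcouplings_def)
  finally show "\<mu> x > 0" using assms(5) by linarith
  have "\<pi> (x, x') \<le> (\<Sum>y\<in>X. \<pi> (y, x'))"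
    using assms nn by (intro member_le_sum[where f = "\<lambda>y. \<pi> (y, x')"]) auto
  also have "\<dots> \<le> \<nu> x'"
    using assms by (auto simp: subcouplings_def)
  finally show "\<nu> x' > 0" using assms(5) by linarith
qed

lemma wf_transport_graph:
  assumes "finite X" "\<pi> \<in> subcouplings X \<mu> \<nu>"
  shows "wf_digraph (transport_graph X \<mu> \<nu> \<pi>)"
  by unfold_locales (auto simp: transport_graph_def dest: subcoupling_arc[OF assms])

end

theory Submission
  imports Defs
begin

text \<open>
  Take a small amount of mass off every arc of a path and give it back at the interior vertices,
  where it stays put at no cost. All marginals are unchanged, except that the first vertex sends
  and the last vertex receives less, so the result is again a sub-coupling. Per unit of removed
  mass the transport cost drops by the length of the path while the penalty grows by \<open>C powr p\<close>;
  optimality compares the two.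
\<close>

text \<open>
  The loops at the last vertex cancel in a list with at least two vertices, so that only the loops
  at the interior vertices remain, with negative sign. Vertices may repeat.
\<close>

fun path_flow :: "'a list \<Rightarrow> 'a \<times> 'a \<Rightarrow> real" where
  "path_flow [] z = 0"
| "path_flow [x] z = of_bool (z = (x, x))"
| "path_flow (x # y # P) z = of_bool (z = (x, y)) - of_bool (z = (y, y)) + path_flow (y # P) z"

text \<open>Crude on purpose: a repeated arc is counted once per traversal, and the length bounds
  this count. It limits how much mass is taken off a single arc.\<close>

lemma path_flow_le_length: "path_flow P z \<le> length P"
  by (induction P z rule: path_flow.induct) auto

text \<open>Off the arcs only loops contribute, with negative sign. A one-vertex list would leave
  its positive final loop uncancelled.\<close>

lemma path_flow_nonpos:
  assumes "length P \<ge> 2" "z \<notin> set (vwalk_arcs P)"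
  shows "path_flow P z \<le> 0"
  using assms
proof (induction P z rule: path_flow.induct)
  case (3 x y P z)
  \<comment> \<open>For \<open>P = []\<close> the tail \<open>[y]\<close> is too short for the
    induction hypothesis; there the two loops at \<open>y\<close> cancel.\<close>
  then show ?case by (cases P) auto
qed auto

text \<open>Telescoping: the negative loop at \<open>y\<close> cancels the row sum of the tail,
  which sits at its head \<open>y\<close>, and leaves the arc out of \<open>x\<close>.\<close>

lemma sum_path_flow_row:
  assumes "finite X" "set P \<subseteq> X" "P \<noteq> []"
  shows "(\<Sum>v\<in>X. path_flow P (u, v)) = of_bool (u = hd P)"
  using assms(2,3)
proof (induction P rule: induct_list012)
  case (3 x y P)
  then show ?case
    using assms(1) by (simp add: sum.distrib sum_subtractf of_bool_conj flip: sum_distrib_left)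
qed (use assms(1) in \<open>auto simp: of_bool_conj simp flip: sum_distrib_left\<close>)

text \<open>The arc \<open>(x, y)\<close> and the loop \<open>(y, y)\<close> lie in the same column
  and cancel, so only the loop of the base case survives.\<close>

lemma sum_path_flow_column:
  assumes "finite X" "set P \<subseteq> X" "P \<noteq> []"
  shows "(\<Sum>u\<in>X. path_flow P (u, v)) = of_bool (v = last P)"
  using assms(2,3)
proof (induction P rule: induct_list012)
  case (3 x y P)
  then show ?case
    using assms(1) by (simp add: sum.distrib sum_subtractf of_bool_conj flip: sum_distrib_right)
qed (use assms(1) in \<open>auto simp: of_bool_conj simp flip: sum_distrib_right\<close>)

lemma path_length_Cons_Cons:
  "path_length d p (x # y # P) = d x y powr p + path_length d p (y # P)"
  by (simp add: path_length_def sum.lessThan_Suc_shift del: sum.lessThan_Suc)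

text \<open>Loops are free, since \<open>d x x = 0\<close> and \<open>0 powr p = 0\<close>; each arc
  contributes its own cost.\<close>

lemma sum_cost_path_flow:
  assumes "finite X" "set P \<subseteq> X" "\<And>x. x \<in> X \<Longrightarrow> d x x = 0"
  shows "(\<Sum>z\<in>X \<times> X. d (fst z) (snd z) powr p * path_flow P z) = path_length d p P"
proof -
  have delta: "(\<Sum>z\<in>X \<times> X. d (fst z) (snd z) powr p * of_bool (z = (x, y))) = d x y powr p"
    if "x \<in> X" "y \<in> X" for x y
    using that assms(1) by (simp add: of_bool_def if_distrib cong: if_cong)
  show ?thesis
    using assms(2)
  proof (induction P rule: induct_list012)
    case (3 x y P)
    then show ?case
      by (simp add: distrib_left right_diff_distrib sum.distrib sum_subtractf delta assms(3)
          path_length_Cons_Cons)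
  qed (auto simp: path_length_def delta assms(3))
qed

lemma uot_cost_alt:
  "uot_cost X d p C \<mu> \<nu> \<pi> =
     (\<Sum>z\<in>X \<times> X. d (fst z) (snd z) powr p * \<pi> z)
     + C powr p * ((total_mass X \<mu> + total_mass X \<nu>) / 2 - (\<Sum>z\<in>X \<times> X. \<pi> z))"
  by (simp add: uot_cost_def total_mass_def sum.cartesian_product case_prod_beta)

lemma uot_cost_reroute:
  assumes "finite X" "set P \<subseteq> X" "P \<noteq> []" "\<And>x. x \<in> X \<Longrightarrow> d x x = 0"
  shows "uot_cost X d p C \<mu> \<nu> (\<lambda>z. \<pi> z - \<epsilon> * path_flow P z) =
    uot_cost X d p C \<mu> \<nu> \<pi> + \<epsilon> * (C powr p - path_length d p P)"
proof -
  have "(\<Sum>z\<in>X \<times> X. path_flow P z) = (\<Sum>u\<in>X. \<Sum>v\<in>X. path_flow P (u, v))"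
    by (simp add: sum.cartesian_product)
  \<comment> \<open>Only the row of \<open>hd P\<close> has a nonzero sum.\<close>
  also have "\<dots> = 1"
    using assms by (simp add: sum_path_flow_row subset_iff)
  finally have mass: "(\<Sum>z\<in>X \<times> X. path_flow P z) = 1" .
  have cost: "(\<Sum>z\<in>X \<times> X. d (fst z) (snd z) powr p * (\<pi> z - \<epsilon> * path_flow P z)) =
      (\<Sum>z\<in>X \<times> X. d (fst z) (snd z) powr p * \<pi> z) - \<epsilon> * path_length d p P"
    by (simp add: right_diff_distrib sum_subtractf mult.left_commute
        sum_cost_path_flow assms flip: sum_distrib_left)
  show ?thesis
    unfolding uot_cost_alt cost
    by (simp add: sum_subtractf mass algebra_simps flip: sum_distrib_left)
qed

lemma reroute_subcoupling:
  fixes \<epsilon> :: real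
  assumes "finite X" "set P \<subseteq> X" "length P \<ge> 2" "\<pi> \<in> subcouplings X \<mu> \<nu>" "\<epsilon> \<ge> 0"
    and small: "\<And>z. z \<in> set (vwalk_arcs P) \<Longrightarrow> \<epsilon> * length P \<le> \<pi> z"
  shows "(\<lambda>z. \<pi> z - \<epsilon> * path_flow P z) \<in> subcouplings X \<mu> \<nu>"
proof -
  have "P \<noteq> []" using assms(3) by auto
  have nn: "\<epsilon> * path_flow P z \<le> \<pi> z" if "z \<in> X \<times> X" for z
  proof (cases "z \<in> set (vwalk_arcs P)")
    case True
    then show ?thesis
      using small[of z] mult_left_mono[OF path_flow_le_length assms(5), of P z] by linarith
  next
    case False
    moreover have "\<pi> z \<ge> 0"
      using assms(4) that by (auto simp: subcouplings_def nonneg_measures_def Pi_iff)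
    ultimately show ?thesis
      using mult_nonneg_nonpos[OF assms(5) path_flow_nonpos[OF assms(3)]] by fastforce
  qed
  \<comment> \<open>The flow has nonnegative row and column sums, so subtracting it cannot raise a
    marginal.\<close>
  have row: "(\<Sum>v\<in>X. \<pi> (u, v) - \<epsilon> * path_flow P (u, v)) \<le> (\<Sum>v\<in>X. \<pi> (u, v))" for u
    using assms \<open>P \<noteq> []\<close>
    by (simp add: sum_subtractf sum_path_flow_row flip: sum_distrib_left)
  have col: "(\<Sum>u\<in>X. \<pi> (u, v) - \<epsilon> * path_flow P (u, v)) \<le> (\<Sum>u\<in>X. \<pi> (u, v))" for v
    using assms \<open>P \<noteq> []\<close>
    by (simp add: sum_subtractf sum_path_flow_column flip: sum_distrib_left)
  show ?thesis
    using assms(4) nn row col order_trans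
    unfolding subcouplings_def nonneg_measures_def by fastforce
qed

lemma path_length_le_of_optimal:
  assumes "finite X" "\<And>x. x \<in> X \<Longrightarrow> d x x = 0" "uot_optimal X d p C \<mu> \<nu> \<pi>"
    and "set P \<subseteq> X" and pos: "\<And>z. z \<in> set (vwalk_arcs P) \<Longrightarrow> \<pi> z > 0"
  shows "path_length d p P \<le> C powr p"
proof (cases "length P \<ge> 2")
  case False
  \<comment> \<open>Here \<open>length P - 1\<close> is 0, also for the empty list, so the sum is
    empty.\<close>
  then show ?thesis by (simp add: path_length_def)
next
  case True
  let ?m = "Min (\<pi> ` set (vwalk_arcs P))"
  \<comment> \<open>Dividing the least mass on the path by its length keeps every arc nonnegative
    even if the path uses it repeatedly.\<close>
  define \<epsilon> where "\<epsilon> = ?m / length P"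
  have "P \<noteq> []" using True by auto
  moreover have "vwalk_arcs P \<noteq> []"
    using True by (cases P rule: vwalk_arcs.cases) auto
  ultimately have "\<epsilon> > 0"
    using pos by (simp add: \<epsilon>_def)
  have "\<epsilon> * length P = ?m" using \<open>P \<noteq> []\<close> by (simp add: \<epsilon>_def)
  then have "(\<lambda>z. \<pi> z - \<epsilon> * path_flow P z) \<in> subcouplings X \<mu> \<nu>"
    using assms True \<open>\<epsilon> > 0\<close>
    by (intro reroute_subcoupling) (auto simp: uot_optimal_def is_arg_min_def)
  then have "uot_cost X d p C \<mu> \<nu> \<pi> \<le> uot_cost X d p C \<mu> \<nu> (\<lambda>z. \<pi> z - \<epsilon> * path_flow P z)"
    using assms(3) by (auto simp: uot_optimal_def is_arg_min_linorder)
  then have "0 \<le> \<epsilon> * (C powr p - path_length d p P)"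
    using uot_cost_reroute[of X P d] assms(1,2,4) \<open>P \<noteq> []\<close> by simp
  then show ?thesis
    using \<open>\<epsilon> > 0\<close> by (simp add: zero_le_mult_iff)
qed

theorem lemma2p1:
  fixes X :: "'a set" and d :: "'a \<Rightarrow> 'a \<Rightarrow> real" and p C :: real
    and \<mu> \<nu> :: "'a \<Rightarrow> real" and \<pi> :: "'a \<times> 'a \<Rightarrow> real"
  assumes "Metric_space X d" and "finite X"
    and "p \<ge> 1" and "C > 0"
    and "\<mu> \<in> nonneg_measures X" and "\<nu> \<in> nonneg_measures X"
    and "uot_optimal X d p C \<mu> \<nu> \<pi>"
  shows "(\<forall>P. vpath P (transport_graph X \<mu> \<nu> \<pi>) \<longrightarrow> path_length d p P \<le> C powr p) \<and>
    (\<forall>x\<in>X. \<forall>x'\<in>X. d x x' > C \<longrightarrow> \<pi> (x, x') = 0)"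
proof (intro conjI allI impI ballI)
  interpret Metric_space X d by fact
  \<comment> \<open>Stated for lists rather than for \<open>vpath\<close>, so that it also applies
    directly to \<open>[x, x']\<close>.\<close>
  have bound: "path_length d p P \<le> C powr p"
    if "set P \<subseteq> X" "\<And>z. z \<in> set (vwalk_arcs P) \<Longrightarrow> \<pi> z > 0" for P
    using path_length_le_of_optimal[OF assms(2) _ assms(7) that] mdist_zero by blast
  show "path_length d p P \<le> C powr p" if "vpath P (transport_graph X \<mu> \<nu> \<pi>)" for P
    using that by (intro bound) (auto simp: vpath_def vwalk_def transport_graph_def arcs_ends_def
        arc_to_ends_def)
  fix x x' assume x: "x \<in> X" "x' \<in> X" "d x x' > C"
  have "\<not> d x x' powr p \<le> C powr p"
    using x assms(3,4) powr_less_mono2[of p C "d x x'"] by simp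
  \<comment> \<open>Otherwise the single arc would be a path longer than
    \<open>C powr p\<close>.\<close>
  then have "\<not> \<pi> (x, x') > 0"
    using bound[of "[x, x']"] x by (auto simp: path_length_def)
  moreover have "\<pi> (x, x') \<ge> 0"
    using assms(7) x
    by (auto simp: uot_optimal_def is_arg_min_def subcouplings_def nonneg_measures_def Pi_iff)
  ultimately show "\<pi> (x, x') = 0" by simp
qed

end
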